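(* For any $a,b\in\mathbb{N}_0$, $$t^{\star}(\{2\}^{a},3,\{2\}^{b})=-\frac{4}{\pi}t(\overline{2a+2b+4})-\frac{8}{\pi}t(\overline{2a+2},2b+2)=-\frac{4}{\pi}\sum_{r=1}^{a+b+1}2^{-2r}\left[\binom{2r}{2a+1}(1-2^{-2r})+\binom{2r}{2b+1}\right]\zeta(2r+1)\,t(\overline{2a+2b+3-2r}).$$
   Context: $t^{\star}(\boldsymbol{s})=\sum_{k_1\geq\cdots\geq k_r\geq1}\prod_{j}(2k_j-1)^{-s_j}$ for an index with $s_1>1$; $\{2\}^a$ is $2$ repeated $a$ times. Alternating multiple $t$-values: $t(\boldsymbol{s};\boldsymbol{\sigma})=\sum_{k_1>\cdots>k_r\geq1}\prod_{j}\frac{\sigma_j^{k_j}}{(2k_j-1)^{s_j}}$, where a bar over $s_j$ means $\sigma_j=-1$ and no bar means $\sigma_j=1$. $\zeta$ is the Riemann zeta function. *)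

theory Defs
  imports Complex_Main
begin

fun tstar_trunc :: "nat list \<Rightarrow> nat \<Rightarrow> real" where
  "tstar_trunc [] N = 1"
| "tstar_trunc (s # ss) N = (\<Sum>k = 1..N. tstar_trunc ss k / (2 * real k - 1) ^ s)"

definition tstar :: "nat list \<Rightarrow> real" where
  "tstar ss = lim (\<lambda>N. tstar_trunc ss N)"

text \<open>Truncated alternating multiple t-sums: sum over N >= k1 > k2 > ... > kr >= 1.
  Each index entry is (s_j, bar_j); bar_j = True means sigma_j = -1.\<close>
fun tA_trunc :: "(nat \<times> bool) list \<Rightarrow> nat \<Rightarrow> real" where
  "tA_trunc [] N = 1"
| "tA_trunc ((s, bar) # ss) N =
     (\<Sum>k = 1..N. (if bar then (-1) ^ k else 1) * tA_trunc ss (k - 1) / (2 * real k - 1) ^ s)"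

definition tA :: "(nat \<times> bool) list \<Rightarrow> real" where
  "tA ss = lim (\<lambda>N. tA_trunc ss N)"

text \<open>Riemann zeta at natural arguments (used for arguments >= 2).\<close>
definition zeta_nat :: "nat \<Rightarrow> real" where
  "zeta_nat s = (\<Sum>n. 1 / real (Suc n) ^ s)"

end

theory Submission
  imports Defs "HOL-Analysis.Analysis" "HOL-Real_Asymp.Real_Asymp"
begin

text \<open>
  Write x(m) = 2 m + 1. The partial fraction coefficients of the truncated products over
  x(m)^2 / (x(m)^2 - X^2) form a triangular kernel in which the operator that sums f(j) / x(j)^2 over
  j up to k acts on the coefficients as multiplication by 1 / x(m)^2. Prepending an entry 2 to the
  index is therefore trivial, and an alternating binomial sum describes the effect of the entry 3.
  As k tends to infinity the kernel tends to 4 / pi (Wallis), which gives the first equality in the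
  form of a series over m with terms (-1)^m G(m) / x(m)^(2a+2), where
  G(m) = x(m)^(-q) + 2 * (sum of x(l)^(-q) over l < m) and q = 2 b + 2.

  For the second equality, - G(m) is the sum over j > 0 of (x(m) + 2j)^(-q) - (2j - x(m))^(-q).
  After exchanging the two summations, for fixed j one expands 1 / (x^p (x + 2j)^q) into partial
  fractions and sums over all odd integers x, positive and negative, with alternating signs. Shifting
  x by 2j multiplies such a sum by (-1)^j, and only odd exponents survive; the remaining sum over j
  yields the zeta values.
\<close>

section \<open>The triangular kernel and its recurrences\<close>

definition od :: "nat \<Rightarrow> real" where
  "od n = 2 * real n + 1"

lemma od_pos [simp]: "od n > 0" and od_nonzero [simp]: "od n \<noteq> 0"
  by (auto simp: od_def)

text \<open>The square of the double factorial (2k+1)!!, divided by 4^k.\<close>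

primrec odd_fact_sq :: "nat \<Rightarrow> real" where
  "odd_fact_sq 0 = 1"
| "odd_fact_sq (Suc k) = odd_fact_sq k * od (Suc k) ^ 2 / 4"

lemma odd_fact_sq_pos [simp]: "odd_fact_sq k > 0"
  by (induction k) auto

text \<open>
  For m up to k, (-1)^m / x(m) times the kernel is the product of x(j)^2 / (x(j)^2 - x(m)^2) over
  all j up to k other than m.
\<close>

definition kernel :: "nat \<Rightarrow> nat \<Rightarrow> real" where
  "kernel k m = (if m \<le> k then odd_fact_sq k / (fact (k - m) * fact (k + m + 1)) else 0)"

definition expand :: "nat \<Rightarrow> (nat \<Rightarrow> real) \<Rightarrow> real" where
  "expand k g = (\<Sum>m\<le>k. (-1) ^ m * kernel k m / od m * g m)"

lemma kernel_nonneg: "kernel k m \<ge> 0"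
  by (simp add: kernel_def less_imp_le)

text \<open>The difference of squares is 4 times the two factors by which the factorials grow from
  \<open>k\<close> to \<open>Suc k\<close>. At \<open>m = Suc k\<close> both sides vanish.\<close>

lemma kernel_Suc_left: "(od (Suc k) ^ 2 - od m ^ 2) * kernel (Suc k) m = od (Suc k) ^ 2 * kernel k m"
proof (cases "m \<le> k")
  case True
  have "od (Suc k) ^ 2 - od m ^ 2 = 4 * (real (k - m) + 1) * (real k + real m + 2)"
    using True by (simp add: od_def power2_eq_square algebra_simps of_nat_diff)
  moreover have "(fact (Suc k - m) :: real) = (real (k - m) + 1) * fact (k - m)"
    using True by (simp add: Suc_diff_le)
  moreover have "(fact (Suc k + m + 1) :: real) = (real k + real m + 2) * fact (k + m + 1)"
    by (simp add: algebra_simps)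
  moreover have "kernel (Suc k) m = odd_fact_sq k * od (Suc k) ^ 2 / 4 / (fact (Suc k - m) * fact (Suc k + m + 1))"
    using True by (simp add: kernel_def)
  moreover have "kernel k m = odd_fact_sq k / (fact (k - m) * fact (k + m + 1))"
    using True by (simp add: kernel_def)
  moreover have "real (k - m) + 1 \<noteq> 0" "real k + real m + 2 \<noteq> 0" by linarith+
  ultimately show ?thesis
    by (simp only:) (simp del: fact_Suc add: divide_simps)
qed (auto simp: kernel_def not_le le_Suc_eq)

text \<open>The ratio of neighbours in one row; it carries the tail formula, the limit and the bound
  from one column to the next.\<close>

lemma kernel_Suc_right:
  assumes "m \<le> k"
  shows "(real k + real m + 2) * kernel k (Suc m) = (real k - real m) * kernel k m"
proof (cases "m = k")
  case False
  with assms have lt: "m < k" by simp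
  have "(fact (k - m) :: real) = (real k - real m) * fact (k - Suc m)"
    using lt by (simp add: fact_reduce of_nat_diff)
  moreover have "(fact (k + Suc m + 1) :: real) = (real k + real m + 2) * fact (k + m + 1)"
    by (simp add: algebra_simps)
  moreover have "real k - real m \<noteq> 0" "real k + real m + 2 \<noteq> 0" using lt by linarith+
  ultimately show ?thesis
    using lt by (simp add: kernel_def divide_simps)
qed (auto simp: kernel_def)

text \<open>Downward induction from \<open>l = k\<close>, where both sides are 0. This closed form
  makes the double sum in \<open>expand_double\<close> collapse.\<close>

lemma alternating_ker_tail:
  assumes "l \<le> k"
  shows "(\<Sum>m = Suc l..k. (-1) ^ m * kernel k m) = (-1) ^ l * kernel k l * (od l / od k - 1) / 2"
  using assms
proof (induction rule: inc_induct)
  case (step n)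
  have "(\<Sum>m = Suc n..k. (-1) ^ m * kernel k m) =
      (-1) ^ Suc n * kernel k (Suc n) + (\<Sum>m = Suc (Suc n)..k. (-1) ^ m * kernel k m)"
    using step.hyps by (subst sum.atLeast_Suc_atMost) auto
  also have "\<dots> = - ((-1) ^ n) * ((real k + real n + 2) * kernel k (Suc n)) / od k"
    unfolding step.IH by (simp add: field_simps) (simp add: od_def algebra_simps)
  also have "\<dots> = (-1) ^ n * kernel k n * (od n / od k - 1) / 2"
    unfolding kernel_Suc_right[OF less_imp_le[OF step.hyps(2)]]
    by (simp add: field_simps) (simp add: od_def algebra_simps)
  finally show ?case .
qed auto

section \<open>Summation rules for \<open>expand\<close>\<close>

text \<open>A rearrangement of \<open>kernel_Suc_left\<close>; both sums can run up to
  \<open>Suc k\<close> because \<open>kernel k (Suc k) = 0\<close>.\<close>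

lemma expand_diff:
  "expand (Suc k) g - expand k g = expand (Suc k) (\<lambda>m. od m ^ 2 * g m) / od (Suc k) ^ 2"
proof -
  have "expand k g = (\<Sum>m\<le>Suc k. (-1) ^ m * kernel k m / od m * g m)"
    by (simp add: expand_def kernel_def)
  then have "expand (Suc k) g - expand k g =
      (\<Sum>m\<le>Suc k. (-1) ^ m / od m * g m * (kernel (Suc k) m - kernel k m))"
    by (simp add: expand_def sum_subtractf[symmetric] field_simps del: sum.atMost_Suc)
  also have "\<dots> = (\<Sum>m\<le>Suc k. (-1) ^ m * kernel (Suc k) m / od m * (od m ^ 2 * g m) / od (Suc k) ^ 2)"
  proof (intro sum.cong refl)
    fix m
    have "kernel (Suc k) m - kernel k m = kernel (Suc k) m * od m ^ 2 / od (Suc k) ^ 2"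
      using kernel_Suc_left[of k m] by (simp add: field_simps)
    then show "(-1) ^ m / od m * g m * (kernel (Suc k) m - kernel k m) =
        (-1) ^ m * kernel (Suc k) m / od m * (od m ^ 2 * g m) / od (Suc k) ^ 2"
      by simp
  qed
  finally show ?thesis
    by (simp only: expand_def sum_divide_distrib)
qed

lemma expand_0 [simp]: "expand 0 g = g 0"
  by (simp add: expand_def kernel_def od_def)

lemma sum_expand:
  "(\<Sum>j\<le>k. expand j g / od j ^ 2) = expand k (\<lambda>m. g m / od m ^ 2)"
proof (induction k)
  case (Suc k)
  then show ?case
    using expand_diff[of k "\<lambda>m. g m / od m ^ 2"] by simp
qed (simp add: od_def)

text \<open>Exchanging the summations leaves kernel tails, and \<open>P l\<close> plus twice its
  tail is \<open>P l * od l / od k\<close>. Read from right to left, this absorbs the extra factor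
  \<open>1 / od k\<close> by which an entry 3 differs from an entry 2.\<close>

lemma expand_double:
  "expand k (\<lambda>m. od m * (h m + 2 * (\<Sum>l<m. h l))) = expand k (\<lambda>m. od m ^ 2 * h m) / od k"
proof -
  define P where "P m = (-1) ^ m * kernel k m" for m
  have tail: "P l + 2 * (\<Sum>m = Suc l..k. P m) = P l * od l / od k" if "l \<le> k" for l
    using alternating_ker_tail[OF that] by (simp add: P_def field_simps)
  have "expand k (\<lambda>m. od m * (h m + 2 * (\<Sum>l<m. h l))) =
      (\<Sum>m\<le>k. P m * h m) + 2 * (\<Sum>m\<le>k. \<Sum>l<m. P m * h l)"
    by (simp add: expand_def P_def algebra_simps sum.distrib sum_distrib_left)
  also have "(\<Sum>m\<le>k. \<Sum>l<m. P m * h l) = (\<Sum>l\<le>k. \<Sum>m = Suc l..k. P m * h l)"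
    by (subst sum.nested_swap') (simp add: lessThan_Suc_atMost[symmetric])
  also have "(\<Sum>m\<le>k. P m * h m) + 2 * (\<Sum>l\<le>k. \<Sum>m = Suc l..k. P m * h l) =
      (\<Sum>l\<le>k. (P l + 2 * (\<Sum>m = Suc l..k. P m)) * h l)"
    by (simp add: sum.distrib sum_distrib_left sum_distrib_right algebra_simps)
  also have "\<dots> = (\<Sum>l\<le>k. P l * od l / od k * h l)"
    by (intro sum.cong) (auto simp: tail)
  also have "\<dots> = expand k (\<lambda>m. od m ^ 2 * h m) / od k"
    by (simp add: expand_def P_def sum_divide_distrib power2_eq_square mult.assoc)
  finally show ?thesis .
qed

text \<open>For \<open>h = 1\<close> the doubled sum is \<open>1 + 2 * m = od m\<close>, so
  \<open>expand_double\<close> equates a quantity with itself divided by \<open>od (Suc k)\<close>,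
  which is not 1. Hence it is 0, and by \<open>expand_diff\<close> the value does not change with
  \<open>k\<close>.\<close>

lemma expand_one: "expand k (\<lambda>_. 1) = 1"
proof (induction k)
  case (Suc k)
  have "expand (Suc k) (\<lambda>m. od m ^ 2) = expand (Suc k) (\<lambda>m. od m ^ 2) / od (Suc k)"
    using expand_double[of "Suc k" "\<lambda>_. 1"] by (simp add: od_def power2_eq_square algebra_simps)
  moreover have "od (Suc k) \<noteq> 1" by (simp add: od_def)
  ultimately have "expand (Suc k) (\<lambda>m. od m ^ 2) = 0" by (simp add: field_simps)
  then show ?case
    using expand_diff[of k "\<lambda>_. 1"] Suc by simp
qed simp

section \<open>Truncated star sums as expansions\<close>

lemma tstar_trunc_Cons_Suc:
  "tstar_trunc (s # ss) (Suc k) = (\<Sum>j\<le>k. tstar_trunc ss (Suc j) / od j ^ s)"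
  unfolding tstar_trunc.simps One_nat_def sum.atLeast1_atMost_eq lessThan_Suc_atMost
  by (simp add: od_def algebra_simps)

lemma tstar_trunc_twos_append:
  assumes "\<And>k. tstar_trunc ss (Suc k) = expand k g"
  shows "tstar_trunc (replicate a 2 @ ss) (Suc k) = expand k (\<lambda>m. g m / od m ^ (2 * a))"
proof (induction a arbitrary: k)
  case (Suc a)
  have "tstar_trunc (replicate (Suc a) 2 @ ss) (Suc k) =
      (\<Sum>j\<le>k. expand j (\<lambda>m. g m / od m ^ (2 * a)) / od j ^ 2)"
    unfolding replicate_Suc append_Cons tstar_trunc_Cons_Suc Suc.IH ..
  also have "\<dots> = expand k (\<lambda>m. g m / od m ^ (2 * Suc a))"
    unfolding sum_expand by (simp add: power2_eq_square mult_ac)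
  finally show ?case .
qed (simp add: assms)

text \<open>The function \<open>G\<close> of the opening text, with \<open>q\<close> kept
  general.\<close>

definition bracket :: "nat \<Rightarrow> nat \<Rightarrow> real" where
  "bracket q m = 1 / od m ^ q + 2 * (\<Sum>l<m. 1 / od l ^ q)"

text \<open>The index is built from the right: the last twos start from \<open>expand_one\<close>,
  the 3 uses \<open>expand_double\<close>, and the leading twos only divide the
  coefficients.\<close>

lemma tstar_trunc_twos_3_twos:
  "tstar_trunc (replicate a 2 @ [3] @ replicate b 2) (Suc k) =
     expand k (\<lambda>m. bracket (2 * b + 2) m / od m ^ (2 * a + 1))"
proof -
  have twos: "tstar_trunc (replicate b 2) (Suc k) = expand k (\<lambda>m. 1 / od m ^ (2 * b))" for k
    using tstar_trunc_twos_append[of "[]" "\<lambda>_. 1" b k] by (simp add: expand_one)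
  have "tstar_trunc ([3] @ replicate b 2) (Suc k) =
      expand k (\<lambda>m. bracket (2 * b + 2) m / od m)" for k
  proof -
    have "tstar_trunc ([3] @ replicate b 2) (Suc k) =
        (\<Sum>j\<le>k. expand j (\<lambda>m. 1 / od m ^ (2 * b)) / od j / od j ^ 2)"
      by (simp add: tstar_trunc_Cons_Suc twos power3_eq_cube power2_eq_square mult.assoc del: tstar_trunc.simps)
    \<comment> \<open>The match \<open>1 / od m ^ (2 * b) = od m ^ 2 * h m\<close> forces the
      exponent \<open>2 * b + 2\<close> in \<open>h\<close>.\<close>
    also have "\<dots> = (\<Sum>j\<le>k. expand j (\<lambda>m. od m * bracket (2 * b + 2) m) / od j ^ 2)"
      using expand_double[where h = "\<lambda>m. 1 / od m ^ (2 * b + 2)"]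
      by (simp add: bracket_def power_add power2_eq_square)
    also have "\<dots> = expand k (\<lambda>m. bracket (2 * b + 2) m / od m)"
      unfolding sum_expand by (simp add: power2_eq_square)
    finally show ?thesis .
  qed
  from tstar_trunc_twos_append[OF this, of a k] show ?thesis
    by (simp add: power_add)
qed

section \<open>Limit and bound of the kernel\<close>

text \<open>Column 0 is the reciprocal of the Wallis product up to a rational factor; both the limit
  and the bound follow from this.\<close>

lemma kernel_0_wallis:
  "kernel k 0 * (\<Prod>i=1..k. (4 * real i ^ 2) / (4 * real i ^ 2 - 1)) = (2 * real k + 1) / (real k + 1)"
proof (induction k)
  case (Suc k)
  let ?w = "\<Prod>i=1..k. (4 * real i ^ 2) / (4 * real i ^ 2 - 1)"
  have nz: "4 * real (Suc k) ^ 2 - 1 = (2 * real k + 1) * (2 * real k + 3)"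
    by (simp add: power2_eq_square algebra_simps)
  have "kernel (Suc k) 0 * (4 * (real k + 1) * (real k + 2)) = (2 * real k + 3) ^ 2 * kernel k 0"
    using kernel_Suc_left[of k 0] by (simp add: od_def power2_eq_square algebra_simps)
  then have kernel: "kernel (Suc k) 0 = (2 * real k + 3) ^ 2 * kernel k 0 / (4 * (real k + 1) * (real k + 2))"
    by (simp add: nonzero_eq_divide_eq)
  have "kernel (Suc k) 0 * (?w * ((4 * real (Suc k) ^ 2) / (4 * real (Suc k) ^ 2 - 1))) =
     (kernel k 0 * ?w) * ((2 * real k + 3) ^ 2 * (4 * (real k + 1) ^ 2) /
       (4 * (real k + 1) * (real k + 2) * ((2 * real k + 1) * (2 * real k + 3))))"
    unfolding kernel nz by (simp add: add.commute)
  also have "\<dots> = (2 * real (Suc k) + 1) / (real (Suc k) + 1)"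
    unfolding Suc.IH by (simp add: divide_simps power2_eq_square) (simp add: algebra_simps)
  finally show ?case by simp
qed (simp add: kernel_def)

lemma kernel_tendsto: "(\<lambda>k. kernel k m) \<longlonglongrightarrow> 4 / pi"
proof (induction m)
  case 0
  define w where "w k = (\<Prod>i=1..k. (4 * real i ^ 2) / (4 * real i ^ 2 - 1))" for k
  have w: "w \<longlonglongrightarrow> pi / 2" unfolding w_def by (rule wallis)
  have nz: "w k \<noteq> 0" for k
    using kernel_0_wallis[of k] unfolding w_def[symmetric] by auto
  have "(\<lambda>k. (2 * real k + 1) / (real k + 1) / w k) \<longlonglongrightarrow> 2 / (pi / 2)"
    by (intro tendsto_divide w) (real_asymp, simp)
  moreover have "(2 * real k + 1) / (real k + 1) / w k = kernel k 0" for k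
    unfolding kernel_0_wallis[of k, folded w_def, symmetric] using nz[of k]
    by (simp add: divide_eq_eq)
  ultimately show ?case by simp
next
  case (Suc m)
  have "(\<lambda>k. (real k - real m) / (real k + real m + 2) * kernel k m) \<longlonglongrightarrow> 1 * (4 / pi)"
    by (intro tendsto_mult Suc) real_asymp
  moreover have "\<forall>\<^sub>F k in sequentially. (real k - real m) / (real k + real m + 2) * kernel k m = kernel k (Suc m)"
    using eventually_ge_at_top[of m]
  proof eventually_elim
    case (elim k)
    have "real k + real m + 2 \<noteq> 0" by linarith
    then show ?case using kernel_Suc_right[OF elim] by (simp add: field_simps)
  qed
  ultimately show ?case by (simp add: tendsto_cong)
qed

text \<open>Rows decrease in \<open>m\<close>, and in column 0 the Wallis product is at least 1. The
  uniform bound supplies the majorant for Tannery's theorem.\<close>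

lemma kernel_le: "kernel k m \<le> 2"
proof -
  have "kernel k m \<le> kernel k 0"
  proof (induction m)
    case (Suc m)
    show ?case
    proof (cases "m \<le> k")
      case True
      have "(real k + real m + 2) * kernel k (Suc m) \<le> (real k + real m + 2) * kernel k m"
        unfolding kernel_Suc_right[OF True] by (intro mult_right_mono kernel_nonneg) simp
      then have "kernel k (Suc m) \<le> kernel k m" by (simp add: mult_le_cancel_left)
      with Suc show ?thesis by simp
    qed (simp add: kernel_def not_le less_imp_le)
  qed simp
  also have "\<dots> \<le> 2"
  proof -
    let ?w = "\<Prod>i=1..k. (4 * real i ^ 2) / (4 * real i ^ 2 - 1)"
    have "?w \<ge> 1"
    proof (rule prod_ge_1)
      fix i assume "i \<in> {1..k}"
      then have "real i ^ 2 \<ge> 1" by simp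
      then show "1 \<le> 4 * (real i)\<^sup>2 / (4 * (real i)\<^sup>2 - 1)" by (simp add: divide_simps)
    qed
    then have "kernel k 0 * 1 \<le> kernel k 0 * ?w" by (intro mult_left_mono kernel_nonneg)
    also have "\<dots> \<le> 2" unfolding kernel_0_wallis by (simp add: field_simps)
    finally show ?thesis by simp
  qed
  finally show ?thesis .
qed

section \<open>The star value as an infinite series\<close>

lemma tannery_sequence:
  fixes f :: "nat \<Rightarrow> nat \<Rightarrow> real"
  assumes "\<And>m. (\<lambda>k. f k m) \<longlonglongrightarrow> g m" "\<And>k m. \<bar>f k m\<bar> \<le> M m" "summable M"
  shows "(\<lambda>k. \<Sum>m. f k m) \<longlonglongrightarrow> (\<Sum>m. g m)"
  using tannerys_theorem[of "\<lambda>m k. f k m" g sequentially M] assms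
  by (auto intro!: always_eventually)

lemma summable_od:
  assumes "q \<ge> 2"
  shows "summable (\<lambda>n. 1 / od n ^ q)"
proof (rule summable_comparison_test)
  have "summable (\<lambda>n. inverse (real n ^ q))"
    using assms by (rule inverse_power_summable)
  then show "summable (\<lambda>n. inverse (real (Suc n) ^ q))"
    by (subst summable_Suc_iff)
  have "norm (1 / od n ^ q) \<le> inverse (real (Suc n) ^ q)" for n
  proof -
    have "real (Suc n) ^ q \<le> od n ^ q" by (intro power_mono) (auto simp: od_def)
    then show ?thesis by (simp add: field_simps)
  qed
  then show "\<exists>N. \<forall>n\<ge>N. norm (1 / od n ^ q) \<le> inverse (real (Suc n) ^ q)" by blast
qed

text \<open>Serves as a uniform bound for the partial sums; as a limit it cancels in
  \<open>bracket_series_eq_zeta_sum\<close>.\<close>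

definition odd_zeta :: "nat \<Rightarrow> real" where
  "odd_zeta q = (\<Sum>n. 1 / od n ^ q)"

lemma odd_zeta_sum_le:
  assumes "q \<ge> 2"
  shows "(\<Sum>l<m. 1 / od l ^ q) \<le> odd_zeta q"
  unfolding odd_zeta_def by (intro sum_le_suminf summable_od assms) (auto simp: less_imp_le)

lemma odd_zeta_sum_nonneg: "(\<Sum>l<m. 1 / od l ^ q) \<ge> 0"
  by (intro sum_nonneg) (simp add: less_imp_le)

lemma odd_zeta_sum_tendsto:
  assumes "q \<ge> 2"
  shows "(\<lambda>m. \<Sum>l<m. 1 / od l ^ q) \<longlonglongrightarrow> odd_zeta q"
  using summable_LIMSEQ[OF summable_od[OF assms]] by (simp add: odd_zeta_def)

lemma summable_bounded_div_od:
  assumes "p \<ge> 2" "\<And>m. \<bar>c m\<bar> \<le> C"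
  shows "summable (\<lambda>m. c m / od m ^ p)"
proof (rule summable_comparison_test)
  show "summable (\<lambda>m. C * (1 / od m ^ p))"
    by (intro summable_mult summable_od assms)
  have "norm (c m / od m ^ p) \<le> C * (1 / od m ^ p)" for m
    using assms(2)[of m] by (simp add: divide_right_mono less_imp_le)
  then show "\<exists>N. \<forall>m\<ge>N. norm (c m / od m ^ p) \<le> C * (1 / od m ^ p)" by blast
qed

lemma bracket_nonneg: "bracket q m \<ge> 0"
  using odd_zeta_sum_nonneg[of q m] by (simp add: bracket_def less_imp_le)

lemma bracket_le:
  assumes "q \<ge> 2"
  shows "bracket q m \<le> 2 * odd_zeta q"
proof -
  have "bracket q m \<le> 2 * (\<Sum>l<Suc m. 1 / od l ^ q)"
    by (simp add: bracket_def divide_right_mono less_imp_le)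
  also have "\<dots> \<le> 2 * odd_zeta q"
    by (intro mult_left_mono odd_zeta_sum_le assms) simp
  finally show ?thesis .
qed

lemma summable_bracket:
  assumes "p \<ge> 2" "q \<ge> 2"
  shows "summable (\<lambda>m. bracket q m / od m ^ p)"
  using bracket_le[OF assms(2)] bracket_nonneg
  by (intro summable_bounded_div_od[OF assms(1), where C = "2 * odd_zeta q"]) auto

lemma tstar_eq_bracket_series:
  "tstar (replicate a 2 @ [3] @ replicate b 2) =
     4 / pi * (\<Sum>m. (-1) ^ m * bracket (2 * b + 2) m / od m ^ (2 * a + 2))"
proof -
  define G where "G m = bracket (2 * b + 2) m / od m ^ (2 * a + 2)" for m
  have G: "0 \<le> G m" for m
    unfolding G_def by (intro divide_nonneg_pos bracket_nonneg) simp
  have sG: "summable G"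
    unfolding G_def by (rule summable_bracket) auto
  have "tstar_trunc (replicate a 2 @ [3] @ replicate b 2) (Suc k) = (\<Sum>m. (-1) ^ m * kernel k m * G m)" for k
  proof -
    \<comment> \<open>Each series is finite since the kernel is triangular; written as a series, its
      range no longer depends on \<open>k\<close>.\<close>
    have "(\<Sum>m. (-1) ^ m * kernel k m * G m) = (\<Sum>m\<le>k. (-1) ^ m * kernel k m * G m)"
      by (intro suminf_finite) (auto simp: kernel_def)
    then show ?thesis
      unfolding tstar_trunc_twos_3_twos expand_def by (simp add: G_def)
  qed
  moreover have "(\<lambda>k. \<Sum>m. (-1) ^ m * kernel k m * G m) \<longlonglongrightarrow> (\<Sum>m. (-1) ^ m * (4 / pi) * G m)"
  proof (rule tannery_sequence)
    show "(\<lambda>k. (-1) ^ m * kernel k m * G m) \<longlonglongrightarrow> (-1) ^ m * (4 / pi) * G m" for m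
      by (intro tendsto_intros kernel_tendsto)
    show "\<bar>(-1) ^ m * kernel k m * G m\<bar> \<le> 2 * G m" for k m
      using kernel_le[of k m] kernel_nonneg[of k m] G[of m] by (simp add: abs_mult mult_right_mono)
    show "summable (\<lambda>m. 2 * G m)"
      by (intro summable_mult sG)
  qed
  ultimately have "(\<lambda>k. tstar_trunc (replicate a 2 @ [3] @ replicate b 2) (Suc k))
      \<longlonglongrightarrow> (\<Sum>m. (-1) ^ m * (4 / pi) * G m)"
    by (simp only:)
  then have "(\<lambda>k. tstar_trunc (replicate a 2 @ [3] @ replicate b 2) k)
      \<longlonglongrightarrow> (\<Sum>m. (-1) ^ m * (4 / pi) * G m)"
    by (rule LIMSEQ_imp_Suc)
  then have "tstar (replicate a 2 @ [3] @ replicate b 2) = (\<Sum>m. (4 / pi) * ((-1) ^ m * G m))"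
    unfolding tstar_def by (simp add: limI mult_ac)
  also have "\<dots> = 4 / pi * (\<Sum>m. (-1) ^ m * G m)"
  proof (rule suminf_mult)
    show "summable (\<lambda>m. (-1) ^ m * G m)"
      by (rule summable_comparison_test[OF _ sG]) (auto simp: abs_mult G)
  qed
  finally show ?thesis by (simp add: G_def)
qed

section \<open>Barred t-values as alternating series\<close>

text \<open>Dirichlet's beta function at \<open>i\<close>. The value \<open>i = 1\<close> occurs for
  \<open>r = a + b + 1\<close>; there convergence is only conditional, so Leibniz' criterion is
  used.\<close>

definition beta_sum :: "nat \<Rightarrow> real" where
  "beta_sum i = (\<Sum>m. (-1) ^ m * (1 / od m ^ i))"

lemma tendsto_inverse_affine_power:
  fixes c :: real
  assumes "i > 0"
  shows "(\<lambda>m. 1 / (od m + c) ^ i) \<longlonglongrightarrow> 0" "(\<lambda>m. 1 / (c - od m) ^ i) \<longlonglongrightarrow> 0"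
proof -
  have "(\<lambda>m. 1 / (od m + c)) \<longlonglongrightarrow> 0" "(\<lambda>m. 1 / (c - od m)) \<longlonglongrightarrow> 0"
    unfolding od_def by real_asymp+
  from this[THEN tendsto_power, of i] assms
  show "(\<lambda>m. 1 / (od m + c) ^ i) \<longlonglongrightarrow> 0" "(\<lambda>m. 1 / (c - od m) ^ i) \<longlonglongrightarrow> 0"
    by (simp_all add: power_one_over zero_power)
qed

lemma beta_sum_sums:
  assumes "i > 0"
  shows "(\<lambda>m. (-1) ^ m * (1 / od m ^ i)) sums beta_sum i"
  unfolding beta_sum_def
proof (rule summable_sums, rule summable_Leibniz'(1))
  show "(\<lambda>m. 1 / od m ^ i) \<longlonglongrightarrow> 0"
    using tendsto_inverse_affine_power(1)[OF assms, of 0] by simp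
  show "1 / od (Suc n) ^ i \<le> 1 / od n ^ i" for n
  proof -
    have "od n ^ i \<le> od (Suc n) ^ i" by (intro power_mono) (auto simp: od_def)
    then show ?thesis by (intro divide_left_mono mult_pos_pos) auto
  qed
qed (simp add: less_imp_le)

text \<open>The shift \<open>k = m + 1\<close> turns \<open>(-1) ^ k\<close> into
  \<open>- ((-1) ^ m)\<close>, the source of the minus sign in every barred value.\<close>

lemma tA_trunc_Cons_lessThan:
  "tA_trunc ((s, bar) # ss) N =
     (\<Sum>m<N. (if bar then - ((-1) ^ m) else 1) * tA_trunc ss m / od m ^ s)"
  unfolding tA_trunc.simps One_nat_def sum.atLeast1_atMost_eq
  by (intro sum.cong) (auto simp: od_def algebra_simps)

lemma tA_single_bar:
  assumes "i > 0"
  shows "tA [(i, True)] = - beta_sum i"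
proof -
  have "(\<lambda>m. - ((-1) ^ m * (1 / od m ^ i))) sums (- beta_sum i)"
    by (intro sums_minus beta_sum_sums assms)
  then show ?thesis
    unfolding tA_def tA_trunc_Cons_lessThan sums_def by (simp add: limI)
qed

text \<open>The double value contributes the strict inner sum, the single value the diagonal term
  \<open>1 / od m ^ q\<close>; weighted 2 and 1 they form \<open>bracket\<close>.\<close>

lemma tA_double_bar:
  assumes "p \<ge> 2" "q \<ge> 2"
  shows "tA [(p + q, True)] + 2 * tA [(p, True), (q, False)] =
    - (\<Sum>m. (-1) ^ m * bracket q m / od m ^ p)"
proof -
  define H where "H m = (\<Sum>l<m. 1 / od l ^ q)" for m
  have "(\<lambda>m. - ((-1) ^ m) * H m / od m ^ p) sums (\<Sum>m. - ((-1) ^ m) * H m / od m ^ p)"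
    using odd_zeta_sum_le[OF assms(2)] odd_zeta_sum_nonneg[of q] unfolding H_def
    by (intro summable_sums summable_bounded_div_od[OF assms(1), where C = "odd_zeta q"])
       (auto simp: abs_mult)
  then have s2: "(\<lambda>m. - ((-1) ^ m) * H m / od m ^ p) sums tA [(p, True), (q, False)]"
    unfolding tA_def tA_trunc_Cons_lessThan sums_def H_def by (simp add: limI)
  have s1: "(\<lambda>m. - ((-1) ^ m * (1 / od m ^ (p + q)))) sums tA [(p + q, True)]"
    using assms sums_minus[OF beta_sum_sums[of "p + q"]] by (simp add: tA_single_bar)
  have "(\<lambda>m. - ((-1) ^ m * bracket q m / od m ^ p)) sums
      (tA [(p + q, True)] + 2 * tA [(p, True), (q, False)])"
    using sums_add[OF s1 sums_mult[OF s2, of 2]]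
    by (simp add: bracket_def H_def power_add algebra_simps add_divide_distrib)
  from sums_minus[OF this] show ?thesis
    by (simp add: sums_iff)
qed

section \<open>Alternating sums over all odd integers\<close>

text \<open>The sum of \<open>x ^ i\<close> inverted over all odd \<open>x = 2 n + 1\<close> with
  sign (-1)^n. As \<open>- od m\<close> has the sign opposite to that of \<open>od m\<close>, even
  exponents cancel.\<close>

definition bilateral :: "nat \<Rightarrow> real" where
  "bilateral i = (if odd i then 2 * beta_sum i else 0)"

text \<open>Raising \<open>j\<close> by one moves each term one place along the odd integers and so
  flips its sign. The partial sums then differ only by boundary terms, which tend to 0.\<close>

lemma bilateral_sums:
  assumes i: "i > 0"
  shows "(\<lambda>m. (-1) ^ m * (1 / (od m + 2 * real j) ^ i - 1 / (2 * real j - od m) ^ i))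
           sums ((-1) ^ j * bilateral i)"
proof (induction j)
  case 0
  show ?case
  proof (cases "odd i")
    case True
    then show ?thesis
      using sums_mult[OF beta_sum_sums[OF i], of 2] by (simp add: bilateral_def mult_ac)
  qed (simp add: bilateral_def)
next
  case (Suc j)
  define u where "u m = (-1) ^ m * (1 / (od m + 2 * real j) ^ i)" for m
  define v where "v m = (-1) ^ m * (1 / (2 * real j - od m) ^ i)" for m
  let ?t = "\<lambda>m. (-1) ^ m * (1 / (od m + 2 * real (Suc j)) ^ i - 1 / (2 * real (Suc j) - od m) ^ i)"
  have up: "od m + 2 * real (Suc j) = od (Suc m) + 2 * real j" for m
    by (simp add: od_def)
  have down: "2 * real (Suc j) - od (Suc m) = 2 * real j - od m" for m
    by (simp add: od_def)
  \<comment> \<open>The term that crosses from the positive branch \<open>u\<close> to the negative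
    branch.\<close>
  have start: "2 * real (Suc j) - od 0 = od 0 + 2 * real j"
    by (simp add: od_def)
  have partial: "(\<Sum>m<Suc M. ?t m) = - (\<Sum>m<Suc M. u m - v m) - u (Suc M) - v M" for M
  proof (induction M)
    case 0
    show ?case
      unfolding up sum.lessThan_Suc start by (simp add: u_def v_def)
  next
    case (Suc M)
    have "?t (Suc M) = - u (Suc (Suc M)) + v M"
      unfolding up down by (simp add: u_def v_def algebra_simps)
    then show ?case
      using Suc by (simp add: sum.lessThan_Suc[of _ "Suc M"] del: sum.lessThan_Suc)
  qed
  have "(\<lambda>m. \<bar>u m\<bar>) \<longlonglongrightarrow> 0" "(\<lambda>m. \<bar>v m\<bar>) \<longlonglongrightarrow> 0"
    using tendsto_inverse_affine_power[OF i, of "2 * real j", THEN tendsto_rabs]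
    by (simp_all add: u_def v_def abs_mult)
  then have "u \<longlonglongrightarrow> 0" "v \<longlonglongrightarrow> 0"
    by (simp_all only: tendsto_rabs_zero_iff)
  moreover have "(\<lambda>m. u m - v m) sums ((-1) ^ j * bilateral i)"
    using Suc unfolding u_def v_def by (simp add: right_diff_distrib)
  ultimately have "(\<lambda>M. - (\<Sum>m<Suc M. u m - v m) - u (Suc M) - v M)
      \<longlonglongrightarrow> - ((-1) ^ j * bilateral i) - 0 - 0"
    unfolding sums_def by (intro tendsto_diff tendsto_minus LIMSEQ_Suc) auto
  then have "(\<lambda>M. \<Sum>m<Suc M. ?t m) \<longlonglongrightarrow> (-1) ^ Suc j * bilateral i"
    unfolding partial by simp
  then show ?case
    unfolding sums_def by (rule LIMSEQ_imp_Suc)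
qed

section \<open>Partial fractions\<close>

text \<open>
  With X = 1/x, Y = 1/y and Z = 1/(x + y) the pole at x = 0 of X^(p+1) Z^(q+1) contributes
  the part (X, Y, p, q); exchanging x and x + y turns y into - y, so the other pole contributes
  (Z, - Y, q, p).
\<close>

definition partial_fraction_part :: "real \<Rightarrow> real \<Rightarrow> nat \<Rightarrow> nat \<Rightarrow> real" where
  "partial_fraction_part X Y p q =
     (\<Sum>k\<le>p. (-1) ^ k * real ((q + k) choose q) * X ^ (p + 1 - k) * Y ^ (q + k + 1))"

lemma partial_fraction_part_0_left: "partial_fraction_part X Y 0 q = X * Y ^ (q + 1)"
  by (simp add: partial_fraction_part_def)

lemma partial_fraction_part_Suc_0: "partial_fraction_part X Y (Suc p) 0 = Y * (X ^ (p + 2) - partial_fraction_part X Y p 0)"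
proof -
  have "(\<Sum>k\<le>p. (-1) ^ Suc k * X ^ (p + 1 - k) * Y ^ (Suc k + 1)) =
      - Y * (\<Sum>k\<le>p. (-1) ^ k * X ^ (p + 1 - k) * Y ^ (k + 1))"
    unfolding sum_distrib_left by (intro sum.cong refl) simp
  then show ?thesis
    unfolding partial_fraction_part_def sum.atMost_Suc_shift by (simp add: right_diff_distrib)
qed

text \<open>Pascal's rule on the coefficients. The recurrence mirrors multiplication by
  \<open>X * Z = Y * (X - Z)\<close>.\<close>

lemma partial_fraction_part_Suc_Suc:
  "partial_fraction_part X Y (Suc p) (Suc q) = Y * (partial_fraction_part X Y (Suc p) q - partial_fraction_part X Y p (Suc q))"
proof -
  have pascal: "real ((Suc q + Suc k) choose Suc q) =
      real ((q + Suc k) choose q) + real ((Suc q + k) choose Suc q)" for k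
    by simp
  define A where "A = (\<Sum>k\<le>p. (-1) ^ Suc k * real ((q + Suc k) choose q) * X ^ (p + 1 - k) * Y ^ (q + Suc k + 1))"
  define B where "B = (\<Sum>k\<le>p. (-1) ^ k * real ((Suc q + k) choose Suc q) * X ^ (p + 1 - k) * Y ^ (Suc q + k + 1))"
  have "(\<Sum>k\<le>p. (-1) ^ Suc k * (real ((q + Suc k) choose q) + real ((Suc q + k) choose Suc q))
        * X ^ (p + 1 - k) * Y ^ (Suc q + Suc k + 1)) = Y * A - Y * B"
    unfolding A_def B_def sum_distrib_left sum_subtractf[symmetric]
    by (intro sum.cong refl) (simp add: algebra_simps del: binomial_Suc_Suc)
  then have "partial_fraction_part X Y (Suc p) (Suc q) = X ^ (p + 2) * Y ^ (q + 2) + (Y * A - Y * B)"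
    unfolding partial_fraction_part_def sum.atMost_Suc_shift pascal by simp
  moreover have "partial_fraction_part X Y (Suc p) q = X ^ (p + 2) * Y ^ (q + 1) + A"
    unfolding partial_fraction_part_def sum.atMost_Suc_shift A_def by simp
  moreover have "partial_fraction_part X Y p (Suc q) = B"
    unfolding partial_fraction_part_def B_def ..
  ultimately show ?thesis
    by (simp add: algebra_simps)
qed

lemma partial_fractions_0:
  assumes "X * Z = Y * (X - Z)"
  shows "X ^ (p + 1) * Z = partial_fraction_part X Y p 0 + partial_fraction_part Z (-Y) 0 p"
proof (induction p)
  case 0
  show ?case using assms by (simp add: partial_fraction_part_def algebra_simps)
next
  case (Suc p)
  have "X ^ (Suc p + 1) * Z = X ^ (p + 1) * (X * Z)" by simp
  also have "\<dots> = Y * (X ^ (p + 2) - X ^ (p + 1) * Z)"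
    unfolding assms by (simp add: algebra_simps)
  finally show ?case
    unfolding Suc partial_fraction_part_Suc_0 partial_fraction_part_0_left by (simp add: algebra_simps)
qed

text \<open>The hypothesis is the only relation between the reciprocals that enters, so the identity
  is polynomial and also applies to \<open>-X\<close>. Both sides obey the same recurrence, with
  \<open>q = 0\<close> and \<open>p = 0\<close> as boundary cases.\<close>

lemma partial_fractions:
  assumes "X * Z = Y * (X - Z)"
  shows "X ^ (p + 1) * Z ^ (q + 1) = partial_fraction_part X Y p q + partial_fraction_part Z (-Y) q p"
proof (induction "p + q" arbitrary: p q rule: less_induct)
  case less
  consider "q = 0" | "p = 0" | p' q' where "p = Suc p'" "q = Suc q'"
    by (metis not0_implies_Suc)
  then show ?case
  proof cases
    case 1
    then show ?thesis using partial_fractions_0[OF assms, of p] by simp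
  next
    case 2
    \<comment> \<open>The hypothesis is invariant under exchanging \<open>X\<close> and
      \<open>Z\<close> while negating \<open>Y\<close>.\<close>
    have "Z * X = - Y * (Z - X)" using assms by (simp add: algebra_simps)
    from partial_fractions_0[OF this, of q] 2 show ?thesis by (simp add: mult_ac)
  next
    case 3
    have "X ^ (p + 1) * Z ^ (q + 1) = X ^ (p' + 1) * Z ^ (q' + 1) * (X * Z)"
      by (simp add: 3 mult_ac)
    also have "\<dots> = Y * (X ^ (Suc p' + 1) * Z ^ (q' + 1) - X ^ (p' + 1) * Z ^ (Suc q' + 1))"
      unfolding assms by (simp add: algebra_simps)
    also have "X ^ (Suc p' + 1) * Z ^ (q' + 1) = partial_fraction_part X Y (Suc p') q' + partial_fraction_part Z (-Y) q' (Suc p')"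
      by (rule less) (simp add: 3)
    also have "X ^ (p' + 1) * Z ^ (Suc q' + 1) = partial_fraction_part X Y p' (Suc q') + partial_fraction_part Z (-Y) (Suc q') p'"
      by (rule less) (simp add: 3)
    finally show ?thesis
      unfolding 3 partial_fraction_part_Suc_Suc by (simp add: algebra_simps)
  qed
qed

lemma even_minus_od_nonzero: "2 * real j - od m \<noteq> 0"
proof
  assume "2 * real j - od m = 0"
  then have "real (2 * j) = real (2 * m + 1)" by (simp add: od_def)
  then have "2 * j = 2 * m + 1" unfolding of_nat_eq_iff .
  then show False by presburger
qed

section \<open>Summation over \<open>m\<close> for fixed \<open>j\<close>\<close>

text \<open>Partial fractions at \<open>x = od m\<close> and at \<open>x = - od m\<close>, with
  \<open>y = 2 j\<close>, are subtracted. Powers of \<open>1 / x\<close> are summed by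
  \<open>bilateral_sums\<close> with shift 0, powers of \<open>1 / (x + y)\<close> with shift
  \<open>j\<close>.\<close>

lemma partial_fraction_sums:
  fixes Y :: real
  assumes "j > 0" "odd p"
  defines "Y \<equiv> 1 / (2 * real j)"
  shows "(\<lambda>m. (-1) ^ m * (1 / (od m + 2 * real j) ^ (q + 1) - 1 / (2 * real j - od m) ^ (q + 1)) / od m ^ (p + 1))
    sums ((\<Sum>k\<le>p. ((-1) ^ k * real ((q + k) choose q) * Y ^ (q + k + 1)) * bilateral (p + 1 - k)) +
          (\<Sum>k\<le>q. ((-1) ^ k * real ((p + k) choose p) * (-Y) ^ (p + k + 1)) * ((-1) ^ j * bilateral (q + 1 - k))))"
proof -
  define c where "c k = (-1) ^ k * real ((q + k) choose q) * Y ^ (q + k + 1)" for k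
  define d where "d k = (-1) ^ k * real ((p + k) choose p) * (-Y) ^ (p + k + 1)" for k
  let ?t = "\<lambda>j m i. (-1) ^ m * (1 / (od m + 2 * real j) ^ i - 1 / (2 * real j - od m) ^ i)"
  have "(\<lambda>m. (\<Sum>k\<le>p. c k * ?t 0 m (p + 1 - k)) + (\<Sum>k\<le>q. d k * ?t j m (q + 1 - k)))
      sums ((\<Sum>k\<le>p. c k * ((-1) ^ 0 * bilateral (p + 1 - k))) +
            (\<Sum>k\<le>q. d k * ((-1) ^ j * bilateral (q + 1 - k))))"
    by (intro sums_add sums_sum sums_mult bilateral_sums) auto
  moreover have "(\<Sum>k\<le>p. c k * ?t 0 m (p + 1 - k)) + (\<Sum>k\<le>q. d k * ?t j m (q + 1 - k)) =
      (-1) ^ m * (1 / (od m + 2 * real j) ^ (q + 1) - 1 / (2 * real j - od m) ^ (q + 1)) / od m ^ (p + 1)" for m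
  proof -
    define X Z Z' where "X = 1 / od m" and "Z = 1 / (od m + 2 * real j)" and "Z' = 1 / (2 * real j - od m)"
    have nz: "2 * real j - od m \<noteq> 0" by (rule even_minus_od_nonzero)
    have pos: "od m + 2 * real j > 0" by (simp add: add_pos_nonneg)
    have "X * Z = Y * (X - Z)"
      using assms(1) pos by (simp add: X_def Z_def Y_def divide_simps)
    from partial_fractions[OF this, of p q]
    have 1: "X ^ (p + 1) * Z ^ (q + 1) = partial_fraction_part X Y p q + partial_fraction_part Z (-Y) q p" .
    have "(-X) * Z' = Y * (-X - Z')"
      using assms(1) nz by (simp add: X_def Z'_def Y_def divide_simps)
    \<comment> \<open>Since \<open>p\<close> is odd,
      \<open>(-X) ^ (p + 1) = X ^ (p + 1)\<close>.\<close>
    from partial_fractions[OF this, of p q] assms(2)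
    have 2: "X ^ (p + 1) * Z' ^ (q + 1) = partial_fraction_part (-X) Y p q + partial_fraction_part Z' (-Y) q p" by simp
    have "(\<Sum>k\<le>p. c k * ?t 0 m (p + 1 - k)) = (-1) ^ m * (partial_fraction_part X Y p q - partial_fraction_part (-X) Y p q)"
      unfolding partial_fraction_part_def sum_subtractf[symmetric] sum_distrib_left c_def
      by (intro sum.cong refl) (simp add: X_def algebra_simps flip: power_one_over minus_divide_right)
    moreover have "(\<Sum>k\<le>q. d k * ?t j m (q + 1 - k)) = (-1) ^ m * (partial_fraction_part Z (-Y) q p - partial_fraction_part Z' (-Y) q p)"
      unfolding partial_fraction_part_def sum_subtractf[symmetric] sum_distrib_left d_def
      by (intro sum.cong refl) (simp add: Z_def Z'_def power_one_over algebra_simps)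
    ultimately have "(\<Sum>k\<le>p. c k * ?t 0 m (p + 1 - k)) + (\<Sum>k\<le>q. d k * ?t j m (q + 1 - k)) =
        (-1) ^ m * (X ^ (p + 1) * Z ^ (q + 1) - X ^ (p + 1) * Z' ^ (q + 1))"
      unfolding 1 2 by (simp add: algebra_simps)
    also have "\<dots> = (-1) ^ m * (Z ^ (q + 1) - Z' ^ (q + 1)) * X ^ (p + 1)"
      by (simp only: right_diff_distrib left_diff_distrib mult_ac)
    finally show ?thesis
      by (simp add: X_def Z_def Z'_def power_one_over del: power_Suc)
  qed
  ultimately show ?thesis
    unfolding c_def d_def by simp
qed

lemma sum_lessThan_double:
  fixes f :: "nat \<Rightarrow> real"
  shows "(\<Sum>k<2 * n. f k) = (\<Sum>l<n. f (2 * l) + f (2 * l + 1))"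
  by (induction n) auto

text \<open>Only odd \<open>k = 2 l + 1\<close> survive, and \<open>2 * b + 1 + k = 2 * r\<close>
  with \<open>r = b + 1 + l\<close>. Padding with zeros for \<open>r \<le> b\<close> gives both pole
  contributions the same range.\<close>

lemma sum_bilateral_reindex:
  "(\<Sum>k\<le>2 * a + 1. f (2 * b + 1 + k) * bilateral (2 * a + 1 + 1 - k)) =
   (\<Sum>r = 1..a + b + 1. if r \<le> b then 0 else f (2 * r) * (2 * beta_sum (2 * a + 2 * b + 3 - 2 * r)))"
proof -
  have "(\<Sum>k\<le>2 * a + 1. f (2 * b + 1 + k) * bilateral (2 * a + 1 + 1 - k)) =
      (\<Sum>k<2 * (a + 1). f (2 * b + 1 + k) * bilateral (2 * a + 2 - k))"
    by (intro sum.cong) auto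
  also have "\<dots> = (\<Sum>l<a + 1. f (2 * b + 2 + 2 * l) * (2 * beta_sum (2 * a + 1 - 2 * l)))"
    unfolding sum_lessThan_double by (intro sum.cong) (auto simp: bilateral_def)
  also have "\<dots> = (\<Sum>r = b + 1..a + b + 1. f (2 * r) * (2 * beta_sum (2 * a + 2 * b + 3 - 2 * r)))"
    by (rule sum.reindex_bij_witness[of _ "\<lambda>r. r - (b + 1)" "\<lambda>l. l + b + 1"]) (auto simp: algebra_simps)
  also have "\<dots> = (\<Sum>r = b + 1..a + b + 1. if r \<le> b then 0 else f (2 * r) * (2 * beta_sum (2 * a + 2 * b + 3 - 2 * r)))"
    by (intro sum.cong) auto
  also have "\<dots> = (\<Sum>r = 1..a + b + 1. if r \<le> b then 0 else f (2 * r) * (2 * beta_sum (2 * a + 2 * b + 3 - 2 * r)))"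
    by (rule sum.mono_neutral_left) auto
  finally show ?thesis .
qed

lemma partial_fraction_sums_zeta:
  assumes "j > 0"
  shows "(\<lambda>m. (-1) ^ m * (1 / (od m + 2 * real j) ^ (2 * b + 2) - 1 / (2 * real j - od m) ^ (2 * b + 2))
            / od m ^ (2 * a + 2))
    sums (\<Sum>r = 1..a + b + 1. (real ((2 * r) choose (2 * a + 1)) * (-1) ^ j - real ((2 * r) choose (2 * b + 1)))
            * (1 / (2 * real j)) ^ (2 * r + 1) * (2 * beta_sum (2 * a + 2 * b + 3 - 2 * r)))"
proof -
  define Y where "Y = 1 / (2 * real j)"
  define B where "B r = 2 * beta_sum (2 * a + 2 * b + 3 - 2 * r)" for r
  have "(\<Sum>k\<le>2 * a + 1. ((-1) ^ k * real ((2 * b + 1 + k) choose (2 * b + 1)) * Y ^ (2 * b + 1 + k + 1)) * bilateral (2 * a + 1 + 1 - k)) =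
      (\<Sum>k\<le>2 * a + 1. - ((-1) ^ (2 * b + 1 + k) * real ((2 * b + 1 + k) choose (2 * b + 1)) * Y ^ (2 * b + 1 + k + 1)) * bilateral (2 * a + 1 + 1 - k))"
    by (intro sum.cong) (auto simp: power_add power_mult)
  also have "\<dots> = (\<Sum>r = 1..a + b + 1. if r \<le> b then 0
      else - ((-1) ^ (2 * r) * real ((2 * r) choose (2 * b + 1)) * Y ^ (2 * r + 1)) * B r)"
    unfolding B_def
    by (rule sum_bilateral_reindex[where f = "\<lambda>n. - ((-1) ^ n * real (n choose (2 * b + 1)) * Y ^ (n + 1))"])
  \<comment> \<open>The padding agrees with the binomial coefficient, which vanishes for
    \<open>2 * r < 2 * b + 1\<close>.\<close>
  also have "\<dots> = (\<Sum>r = 1..a + b + 1. - real ((2 * r) choose (2 * b + 1)) * Y ^ (2 * r + 1) * B r)"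
    by (intro sum.cong) (auto simp: binomial_eq_0)
  finally have S1: "(\<Sum>k\<le>2 * a + 1. ((-1) ^ k * real ((2 * b + 1 + k) choose (2 * b + 1)) * Y ^ (2 * b + 1 + k + 1)) * bilateral (2 * a + 1 + 1 - k)) =
      (\<Sum>r = 1..a + b + 1. - real ((2 * r) choose (2 * b + 1)) * Y ^ (2 * r + 1) * B r)" .
  have "(\<Sum>k\<le>2 * b + 1. ((-1) ^ k * real ((2 * a + 1 + k) choose (2 * a + 1)) * (-Y) ^ (2 * a + 1 + k + 1)) * ((-1) ^ j * bilateral (2 * b + 1 + 1 - k))) =
      (\<Sum>k\<le>2 * b + 1. ((-1) ^ j * real ((2 * a + 1 + k) choose (2 * a + 1)) * Y ^ (2 * a + 1 + k + 1)) * bilateral (2 * b + 1 + 1 - k))"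
  proof (intro sum.cong refl)
    fix k
    have "(-Y) ^ (2 * a + 1 + k + 1) = (-1) ^ k * Y ^ (2 * a + 1 + k + 1)"
      by (subst power_minus) (simp add: power_add power_mult)
    then show "((-1) ^ k * real ((2 * a + 1 + k) choose (2 * a + 1)) * (-Y) ^ (2 * a + 1 + k + 1)) * ((-1) ^ j * bilateral (2 * b + 1 + 1 - k)) =
      ((-1) ^ j * real ((2 * a + 1 + k) choose (2 * a + 1)) * Y ^ (2 * a + 1 + k + 1)) * bilateral (2 * b + 1 + 1 - k)"
      by (simp only:) simp
  qed
  also have "\<dots> = (\<Sum>r = 1..b + a + 1. if r \<le> a then 0
      else ((-1) ^ j * real ((2 * r) choose (2 * a + 1)) * Y ^ (2 * r + 1)) * (2 * beta_sum (2 * b + 2 * a + 3 - 2 * r)))"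
    by (rule sum_bilateral_reindex[where f = "\<lambda>n. ((-1) ^ j * real (n choose (2 * a + 1)) * Y ^ (n + 1))"])
  also have "\<dots> = (\<Sum>r = 1..a + b + 1. (real ((2 * r) choose (2 * a + 1)) * (-1) ^ j) * Y ^ (2 * r + 1) * B r)"
    unfolding B_def by (intro sum.cong) (auto simp: binomial_eq_0 add.commute)
  finally have S2: "(\<Sum>k\<le>2 * b + 1. ((-1) ^ k * real ((2 * a + 1 + k) choose (2 * a + 1)) * (-Y) ^ (2 * a + 1 + k + 1)) * ((-1) ^ j * bilateral (2 * b + 1 + 1 - k))) =
      (\<Sum>r = 1..a + b + 1. (real ((2 * r) choose (2 * a + 1)) * (-1) ^ j) * Y ^ (2 * r + 1) * B r)" .
  have "odd (2 * a + 1)" by simp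
  from partial_fraction_sums[OF assms this, of "2 * b + 1"]
  show ?thesis
    unfolding Y_def[symmetric] S1 S2 B_def[symmetric] sum.distrib[symmetric]
    by (simp add: algebra_simps)
qed

section \<open>Summation over \<open>j\<close> and the zeta values\<close>

text \<open>The denominators in \<open>R m\<close> run through the odd integers from
  \<open>1 - 2 m\<close> upwards. As \<open>q\<close> is even, the negative ones contribute
  \<open>H m\<close> and the positive ones tend to \<open>odd_zeta q\<close>.\<close>

lemma bracket_partial_sums:
  assumes "even q"
  defines "H \<equiv> \<lambda>m. \<Sum>l<m. 1 / od l ^ q"
  defines "R \<equiv> \<lambda>m J. \<Sum>j<J. 1 / (2 * real (Suc j) - od m) ^ q"
  assumes "q \<ge> 2"
  shows "(\<Sum>j<J. 1 / (od m + 2 * real (Suc j)) ^ q) = H (m + 1 + J) - H (m + 1)"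
    and "R m \<longlonglongrightarrow> odd_zeta q + H m" and "R m J \<le> odd_zeta q + H m"
proof -
  show "(\<Sum>j<J. 1 / (od m + 2 * real (Suc j)) ^ q) = H (m + 1 + J) - H (m + 1)"
  proof (induction J)
    case (Suc J)
    have "od m + 2 * real (Suc J) = od (m + 1 + J)" by (simp add: od_def)
    with Suc show ?case by (simp add: H_def)
  qed simp
  have R0: "R 0 J = H J" for J
    unfolding R_def H_def by (intro sum.cong) (auto simp: od_def algebra_simps)
  have RSuc: "R (Suc m) J = R m J + 1 / od m ^ q - 1 / (2 * real J - od m) ^ q" for m J
  proof (induction J)
    case 0
    show ?case using assms(1) by (simp add: R_def)
  next
    case (Suc J)
    have "2 * real (Suc J) - od (Suc m) = 2 * real J - od m" by (simp add: od_def)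
    with Suc show ?case by (simp add: R_def del: of_nat_Suc)
  qed
  show "R m \<longlonglongrightarrow> odd_zeta q + H m"
  proof (induction m)
    case 0
    show ?case
      using odd_zeta_sum_tendsto[OF assms(4)] R0 by (simp add: H_def)
  next
    case (Suc m)
    have "(\<lambda>J. 1 / (2 * real J - od m)) \<longlonglongrightarrow> 0"
      unfolding od_def by real_asymp
    from tendsto_power[OF this, of q] have "(\<lambda>J. 1 / (2 * real J - od m) ^ q) \<longlonglongrightarrow> 0"
      using assms(4) by (simp add: power_one_over zero_power)
    from tendsto_diff[OF tendsto_add[OF Suc tendsto_const[of "1 / od m ^ q"]] this]
    show ?case unfolding RSuc[symmetric] by (simp add: H_def add_ac)
  qed
  show "R m J \<le> odd_zeta q + H m"
  proof (induction m)
    case 0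
    show ?case
      using odd_zeta_sum_le[OF assms(4)] R0 by (simp add: H_def)
  next
    case (Suc m)
    have "1 / (2 * real J - od m) ^ q \<ge> 0"
      using assms(1) by (simp add: zero_le_even_power)
    with Suc show ?case unfolding RSuc H_def sum.lessThan_Suc by linarith
  qed
qed

text \<open>The alternating series is the zeta series minus twice its terms with even denominators;
  these sit at odd \<open>n\<close>, where \<open>sums_if\<close> places them.\<close>

lemma alternating_zeta_sums:
  assumes "s \<ge> 2"
  shows "(\<lambda>n. 1 / real (Suc n) ^ s) sums zeta_nat s"
    and "(\<lambda>n. (-1) ^ n / real (Suc n) ^ s) sums ((1 - 2 / 2 ^ s) * zeta_nat s)"
proof -
  have "summable (\<lambda>n. inverse (real n ^ s))"
    using assms by (rule inverse_power_summable)
  then have "summable (\<lambda>n. inverse (real (Suc n) ^ s))"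
    by (subst summable_Suc_iff)
  then show 1: "(\<lambda>n. 1 / real (Suc n) ^ s) sums zeta_nat s"
    unfolding zeta_nat_def by (intro summable_sums) (simp add: inverse_eq_divide)
  have "(\<lambda>n. 2 / 2 ^ s * (1 / real (Suc n) ^ s)) sums (2 / 2 ^ s * zeta_nat s)"
    by (intro sums_mult 1)
  from sums_diff[OF 1 sums_if[OF this sums_zero]]
  have "(\<lambda>n. 1 / real (Suc n) ^ s - (if even n then 0 else 2 / 2 ^ s * (1 / real (Suc ((n - 1) div 2)) ^ s)))
      sums (zeta_nat s - 2 / 2 ^ s * zeta_nat s)"
    by simp
  also have "(\<lambda>n. 1 / real (Suc n) ^ s - (if even n then 0 else 2 / 2 ^ s * (1 / real (Suc ((n - 1) div 2)) ^ s))) =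
      (\<lambda>n. (-1) ^ n / real (Suc n) ^ s)"
  proof
    fix n
    have "real (Suc n) ^ s = 2 ^ s * real (Suc ((n - 1) div 2)) ^ s" if "odd n"
      using that unfolding power_mult_distrib[symmetric] by (auto elim!: oddE)
    then show "1 / real (Suc n) ^ s - (if even n then 0 else 2 / 2 ^ s * (1 / real (Suc ((n - 1) div 2)) ^ s)) =
      (-1) ^ n / real (Suc n) ^ s"
      by auto
  qed
  finally show "(\<lambda>n. (-1) ^ n / real (Suc n) ^ s) sums ((1 - 2 / 2 ^ s) * zeta_nat s)"
    by (simp add: algebra_simps)
qed

text \<open>The series of \<open>E (Suc j)\<close> is evaluated twice: as minus the bracket series,
  by Tannery's theorem in the cutoff \<open>J\<close>, and termwise through zeta values.\<close>

lemma bracket_series_eq_zeta_sum: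
  "(\<Sum>m. (-1) ^ m * bracket (2 * b + 2) m / od m ^ (2 * a + 2)) =
   (\<Sum>r = 1..a + b + 1. 1 / 2 ^ (2 * r) *
      (real ((2 * r) choose (2 * a + 1)) * (1 - 1 / 2 ^ (2 * r)) + real ((2 * r) choose (2 * b + 1)))
      * zeta_nat (2 * r + 1) * beta_sum (2 * a + 2 * b + 3 - 2 * r))"
  (is "?D = ?S")
proof -
  define q where "q = 2 * b + 2"
  define H where "H m = (\<Sum>l<m. 1 / od l ^ q)" for m
  have q: "q \<ge> 2" "even q" by (auto simp: q_def)
  note bps = bracket_partial_sums[OF q(2,1)]
  define T where "T J m = (\<Sum>j<J. 1 / (od m + 2 * real (Suc j)) ^ q - 1 / (2 * real (Suc j) - od m) ^ q)" for J m
  define R where "R m J = (\<Sum>j<J. 1 / (2 * real (Suc j) - od m) ^ q)" for m J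
  define B where "B r = 2 * beta_sum (2 * a + 2 * b + 3 - 2 * r)" for r
  define E where "E j = (\<Sum>r = 1..a + b + 1.
      (real ((2 * r) choose (2 * a + 1)) * (-1) ^ j - real ((2 * r) choose (2 * b + 1)))
            * (1 / (2 * real j)) ^ (2 * r + 1) * B r)" for j
  have T_eq: "T J m = H (m + 1 + J) - H (m + 1) - R m J" for J m
    unfolding T_def sum_subtractf R_def bps(1)[of m J] H_def ..
  have T_tendsto: "(\<lambda>J. T J m) \<longlonglongrightarrow> - bracket q m" for m
  proof -
    have "(\<lambda>J. H (J + (m + 1))) \<longlonglongrightarrow> odd_zeta q"
      unfolding H_def by (intro LIMSEQ_ignore_initial_segment odd_zeta_sum_tendsto q)
    then have "(\<lambda>J. T J m) \<longlonglongrightarrow> odd_zeta q - H (m + 1) - (odd_zeta q + H m)"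
      unfolding T_eq using bps(2)[of m, folded H_def R_def]
      by (intro tendsto_diff tendsto_const) (simp_all add: add_ac)
    then show ?thesis by (simp add: bracket_def H_def algebra_simps)
  qed
  \<comment> \<open>A bound uniform in both \<open>J\<close> and \<open>m\<close>, as the majorant
    requires.\<close>
  have T_bound: "\<bar>T J m\<bar> \<le> 2 * odd_zeta q" for J m
  proof -
    have "R m J \<ge> 0"
      unfolding R_def using q(2) by (intro sum_nonneg) (simp add: zero_le_even_power)
    moreover have "R m J \<le> odd_zeta q + H m"
      using bps(3)[of m J] unfolding R_def H_def .
    moreover have "0 \<le> H (m + 1 + J) - H (m + 1)"
      unfolding H_def bps(1)[symmetric] by (intro sum_nonneg) (simp add: add_nonneg_nonneg less_imp_le)
    moreover have "H (m + 1 + J) \<le> odd_zeta q" "H m \<le> odd_zeta q" "H (m + 1) \<ge> 0"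
      using odd_zeta_sum_le[OF q(1)] odd_zeta_sum_nonneg unfolding H_def by blast+
    ultimately show ?thesis unfolding T_eq by linarith
  qed
  have "(\<lambda>J. \<Sum>m. (-1) ^ m * T J m / od m ^ (2 * a + 2)) \<longlonglongrightarrow>
      (\<Sum>m. (-1) ^ m * (- bracket q m) / od m ^ (2 * a + 2))"
  proof (rule tannery_sequence)
    show "(\<lambda>J. (-1) ^ m * T J m / od m ^ (2 * a + 2)) \<longlonglongrightarrow> (-1) ^ m * (- bracket q m) / od m ^ (2 * a + 2)" for m
      by (intro tendsto_divide tendsto_mult tendsto_const T_tendsto) simp
    show "\<bar>(-1) ^ m * T J m / od m ^ (2 * a + 2)\<bar> \<le> 2 * odd_zeta q / od m ^ (2 * a + 2)" for J m
      using T_bound[of J m] by (simp add: abs_mult divide_right_mono less_imp_le del: power_Suc)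
    show "summable (\<lambda>m. 2 * odd_zeta q / od m ^ (2 * a + 2))"
      by (rule summable_bounded_div_od[where C = "\<bar>2 * odd_zeta q\<bar>"]) auto
  qed
  moreover have "(\<Sum>m. (-1) ^ m * (- bracket q m) / od m ^ (2 * a + 2)) = - ?D"
  proof -
    have "summable (\<lambda>m. (-1) ^ m * bracket q m / od m ^ (2 * a + 2))"
      using bracket_le[OF q(1)] bracket_nonneg
      by (intro summable_bounded_div_od[where C = "2 * odd_zeta q"]) (auto simp: abs_mult)
    from suminf_minus[OF this] show ?thesis by (simp add: q_def)
  qed
  moreover have "(\<Sum>m. (-1) ^ m * T J m / od m ^ (2 * a + 2)) = (\<Sum>j<J. E (Suc j))" for J
  proof -
    have "(\<lambda>m. \<Sum>j<J. (-1) ^ m * (1 / (od m + 2 * real (Suc j)) ^ q - 1 / (2 * real (Suc j) - od m) ^ q)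
        / od m ^ (2 * a + 2)) sums (\<Sum>j<J. E (Suc j))"
      unfolding E_def B_def q_def by (intro sums_sum partial_fraction_sums_zeta) simp
    then show ?thesis
      unfolding T_def sum_distrib_left sum_divide_distrib by (rule sums_unique[symmetric])
  qed
  ultimately have lim: "(\<lambda>j. E (Suc j)) sums (- ?D)"
    by (simp add: sums_def)
  have "(\<lambda>j. E (Suc j)) sums (- ?S)"
  proof -
    define ca where "ca r = real ((2 * r) choose (2 * a + 1))" for r
    define cb where "cb r = real ((2 * r) choose (2 * b + 1))" for r
    \<comment> \<open>At \<open>Suc j\<close> the sign \<open>(-1) ^ Suc j\<close> makes both
      coefficients negative. The 2 in \<open>B\<close> later reduces \<open>2 ^ (2 * r + 1)\<close>
      to \<open>2 ^ (2 * r)\<close>.\<close>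
    have "(\<lambda>j. \<Sum>r = 1..a + b + 1. - (ca r * B r / 2 ^ (2 * r + 1)) * ((-1) ^ j / real (Suc j) ^ (2 * r + 1))
           + - (cb r * B r / 2 ^ (2 * r + 1)) * (1 / real (Suc j) ^ (2 * r + 1)))
      sums (\<Sum>r = 1..a + b + 1. - (ca r * B r / 2 ^ (2 * r + 1)) * ((1 - 2 / 2 ^ (2 * r + 1)) * zeta_nat (2 * r + 1))
           + - (cb r * B r / 2 ^ (2 * r + 1)) * zeta_nat (2 * r + 1))"
      by (intro sums_sum sums_add sums_mult alternating_zeta_sums) auto
    moreover have "(\<Sum>r = 1..a + b + 1. - (ca r * B r / 2 ^ (2 * r + 1)) * ((-1) ^ j / real (Suc j) ^ (2 * r + 1))
           + - (cb r * B r / 2 ^ (2 * r + 1)) * (1 / real (Suc j) ^ (2 * r + 1))) = E (Suc j)" for j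
    proof -
      have "(1 / (2 * real (Suc j))) ^ n = 1 / 2 ^ n * (1 / real (Suc j) ^ n)" for n
        by (simp only: power_one_over power_mult_distrib times_divide_times_eq mult_1)
      then show ?thesis
        unfolding E_def ca_def[symmetric] cb_def[symmetric]
        by (intro sum.cong refl) (simp only:, simp add: algebra_simps add_divide_distrib diff_divide_distrib del: of_nat_Suc)
    qed
    moreover have "(\<Sum>r = 1..a + b + 1. - (ca r * B r / 2 ^ (2 * r + 1)) * ((1 - 2 / 2 ^ (2 * r + 1)) * zeta_nat (2 * r + 1))
           + - (cb r * B r / 2 ^ (2 * r + 1)) * zeta_nat (2 * r + 1)) = - ?S"
      unfolding sum_negf[symmetric] ca_def[symmetric] cb_def[symmetric] B_def
      by (intro sum.cong refl) (simp add: field_simps)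
    ultimately show ?thesis by simp
  qed
  from sums_unique2[OF lim this] show ?thesis by simp
qed

section \<open>The two equalities\<close>

theorem theorem4p2:
  fixes a b :: nat
  shows "tstar (replicate a 2 @ [3] @ replicate b 2)
           = - 4 / pi * tA [(2*a + 2*b + 4, True)]
             - 8 / pi * tA [(2*a + 2, True), (2*b + 2, False)]
       \<and> - 4 / pi * tA [(2*a + 2*b + 4, True)]
             - 8 / pi * tA [(2*a + 2, True), (2*b + 2, False)]
           = - 4 / pi * (\<Sum>r = 1..a + b + 1. 2 powi (- 2 * int r) *
                 (real ((2*r) choose (2*a + 1)) * (1 - 2 powi (- 2 * int r))
                  + real ((2*r) choose (2*b + 1)))
                 * zeta_nat (2*r + 1) * tA [(2*a + 2*b + 3 - 2*r, True)])"
proof -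
  \<comment> \<open>All three expressions are shown to equal \<open>4 / pi * D\<close>.\<close>
  define D where "D = (\<Sum>m. (-1) ^ m * bracket (2 * b + 2) m / od m ^ (2 * a + 2))"
  have "2 * a + 2 + (2 * b + 2) = 2 * a + 2 * b + 4" by simp
  then have "tA [(2*a + 2*b + 4, True)] + 2 * tA [(2*a + 2, True), (2*b + 2, False)] = - D"
    using tA_double_bar[of "2 * a + 2" "2 * b + 2"] by (simp only: D_def le_add2)
  then have "- 4 / pi * (tA [(2*a + 2*b + 4, True)] + 2 * tA [(2*a + 2, True), (2*b + 2, False)]) = 4 / pi * D"
    by simp
  then have mid: "- 4 / pi * tA [(2*a + 2*b + 4, True)] - 8 / pi * tA [(2*a + 2, True), (2*b + 2, False)] = 4 / pi * D"
    by (simp add: algebra_simps)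
  have powi: "(2 :: real) powi (- 2 * int r) = 1 / 2 ^ (2 * r)" for r
  proof -
    have "- 2 * int r = - int (2 * r)" by simp
    then show ?thesis by (simp only: power_int_minus power_int_of_nat inverse_eq_divide)
  qed
  have "(\<Sum>r = 1..a + b + 1. 2 powi (- 2 * int r) *
                 (real ((2*r) choose (2*a + 1)) * (1 - 2 powi (- 2 * int r))
                  + real ((2*r) choose (2*b + 1)))
                 * zeta_nat (2*r + 1) * tA [(2*a + 2*b + 3 - 2*r, True)]) = - D"
    unfolding D_def bracket_series_eq_zeta_sum sum_negf[symmetric] powi
    by (intro sum.cong refl) (simp add: tA_single_bar)
  then show ?thesis
    unfolding mid tstar_eq_bracket_series D_def[symmetric] by simp
qed

end
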